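(* Let $n\ge 2$, let $O$ be a point outside a closed convex set $\mathcal C\subset\mathbb R^n$ with nonempty interior, and let the segment $[A^*B^*]$ be a local minimizer for $G$. Suppose that $[A^*B^*]$ intersects the interior of $\mathcal C$. Then: (i) There exists only one hyperplane $\Pi_1$ supporting $\mathcal C$ at $A^*$ and only one hyperplane $\Pi_2$ supporting $\mathcal C$ at $B^*$. (ii) The normal line to $\Pi_1$ at $A^*$ and the normal line to $\Pi_2$ at $B^*$ intersect at a point in the hyperplane through $O$ which is orthogonal to the line $A^*B^*$.
   Context: $\partial\mathcal C$ is the boundary of $\mathcal C$; $|AB|$ is the Euclidean length of $[AB]$. For a closed convex set $\mathcal C$ with nonempty interior and a point $O\notin\mathcal C$, consider all segments $[AB]$ with end-points $A,B\in\partial\mathcal C$ such that the line $AB$ passes through $O$ and $B\in[OA]$; put $G([AB])=|AB|$ for such segments. Such a segment $[A^*B^*]$ is a local minimizer for $G$ if there are open sets $U\ni A^*$ and $V\ni B^*$ such that $|AB|\ge|A^*B^*|$ for every such segment $[AB]$ with $A\in\partial\mathcal C\cap U$ and $B\in\partial\mathcal C\cap V$. A hyperplane $\Pi$ supports $\mathcal C$ at $A\in\mathcal C$ if $A\in\Pi$ and $\mathcal C$ is contained in one of the two closed half-spaces determined by $\Pi$. "The normal lines intersect at a point in a hyperplane" means that there is a point common to both normal lines and the hyperplane (the two normal lines are allowed to coincide). *)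

theory Defs
  imports "HOL-Analysis.Analysis"
begin

(* "p" is the point called O in the source. The segment [AB] is represented by its ordered pair
   of end-points (A, B), B being the one nearer to p; its length is dist A B. *)
definition admissible_segment ::
  "'a::euclidean_space set \<Rightarrow> 'a \<Rightarrow> 'a \<Rightarrow> 'a \<Rightarrow> bool" where
  "admissible_segment C p A B \<longleftrightarrow>
     A \<in> frontier C \<and> B \<in> frontier C \<and> A \<noteq> B \<and>
     p \<in> affine hull {A, B} \<and> B \<in> closed_segment p A"

definition local_minimizer ::
  "'a::euclidean_space set \<Rightarrow> 'a \<Rightarrow> 'a \<Rightarrow> 'a \<Rightarrow> bool" where
  "local_minimizer C p A' B' \<longleftrightarrow>
     admissible_segment C p A' B' \<and>
     (\<exists>U V. open U \<and> open V \<and> A' \<in> U \<and> B' \<in> V \<and>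
        (\<forall>A B. A \<in> frontier C \<inter> U \<and> B \<in> frontier C \<inter> V \<and> admissible_segment C p A B
           \<longrightarrow> dist A B \<ge> dist A' B'))"

definition supports_at ::
  "'a::euclidean_space set \<Rightarrow> 'a set \<Rightarrow> 'a \<Rightarrow> bool" where
  "supports_at H C A \<longleftrightarrow>
     A \<in> C \<and> A \<in> H \<and>
     (\<exists>a b. a \<noteq> 0 \<and> H = {x. a \<bullet> x = b} \<and>
        (C \<subseteq> {x. a \<bullet> x \<le> b} \<or> C \<subseteq> {x. a \<bullet> x \<ge> b}))"

(* A line only when H is a hyperplane. *)
definition normal_line :: "'a::euclidean_space set \<Rightarrow> 'a \<Rightarrow> 'a set" where
  "normal_line H A = {x. \<forall>y\<in>H. \<forall>z\<in>H. orthogonal (x - A) (y - z)}"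

(* The hyperplane through p orthogonal to the line AB; meaningful for distinct A and B. *)
definition orthogonal_hyperplane :: "'a::euclidean_space \<Rightarrow> 'a \<Rightarrow> 'a \<Rightarrow> 'a set" where
  "orthogonal_hyperplane p A B = {x. orthogonal (x - p) (A - B)}"

end

theory Submission
  imports Defs
begin

text \<open>Rotate the segment \<open>[AB]\<close> about \<open>O\<close> by moving its direction to \<open>d + t w\<close> with \<open>w\<close>
  orthogonal to \<open>d = A - B\<close>. The chord of \<open>C\<close> cut out by the rotated line lies between the two
  chosen supporting hyperplanes, so its length is at most an explicit smooth function of \<open>t\<close>
  that equals \<open>|AB|\<close> at \<open>t = 0\<close>. Local minimality forces the derivative of that function to
  vanish at 0. Doing this for all \<open>w\<close> gives a linear relation between the two normal vectors,
  whichever supporting hyperplanes were chosen: each hyperplane determines the other, and the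
  relation says precisely that the normal lines meet in the hyperplane through \<open>O\<close>.\<close>

section \<open>Frontier crossings, a one-variable minimum and chords through
  \<open>p\<close>\<close>

lemma closed_segment_crosses_frontier:
  fixes y v :: "'a::real_normed_vector"
  assumes "(y + s *\<^sub>R v \<in> S) \<noteq> (y + r *\<^sub>R v \<in> S)"
  obtains q where "q \<in> closed_segment s r" "y + q *\<^sub>R v \<in> frontier S"
proof -
  let ?T = "(\<lambda>q. y + q *\<^sub>R v) ` closed_segment s r"
  have "connected ?T"
    by (intro connected_continuous_image continuous_intros connected_segment)
  moreover have "?T \<inter> S \<noteq> {}" "?T - S \<noteq> {}"
    using assms by auto
  ultimately have "?T \<inter> frontier S \<noteq> {}"
    by (rule connected_Int_frontier)
  then show thesis
    using that by blast
qed

text \<open>The right-hand side of \<open>ev\<close> will be the upper bound for the length of the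
  rotated chord. It equals \<open>sqrt D\<close> at 0 because \<open>a - b = 1\<close>, so 0 is a
  local minimum. The square root has derivative 0 there, so only the two fractions contribute to the
  derivative.\<close>

lemma first_order_condition:
  fixes a b \<alpha> \<beta> D W :: real
  assumes "D > 0" "a - b = 1"
    and ev: "\<forall>\<^sub>F t in nhds 0. sqrt D \<le> (a / (1 + t * \<alpha>) - b / (1 + t * \<beta>)) * sqrt (D + t\<^sup>2 * W)"
  shows "a * \<alpha> = b * \<beta>"
proof -
  let ?f = "\<lambda>t. (a / (1 + t * \<alpha>) - b / (1 + t * \<beta>)) * sqrt (D + t\<^sup>2 * W)"
  obtain e where "e > 0" and e: "\<And>t. dist t 0 < e \<Longrightarrow> sqrt D \<le> ?f t"
    using ev unfolding eventually_nhds_metric by blast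
  have "(?f has_real_derivative (b * \<beta> - a * \<alpha>) * sqrt D) (at 0)"
    using assms(1) by (auto intro!: derivative_eq_intros simp: field_simps)
  moreover have "\<forall>t. \<bar>0 - t\<bar> < e \<longrightarrow> ?f 0 \<le> ?f t"
    using e assms(2) by (auto simp: dist_real_def)
  ultimately have "(b * \<beta> - a * \<alpha>) * sqrt D = 0"
    using DERIV_local_min \<open>e > 0\<close> by blast
  then show ?thesis
    using assms(1) by simp
qed

lemma admissible_segmentI:
  assumes "p + s *\<^sub>R v \<in> frontier C" "p + r *\<^sub>R v \<in> frontier C" "0 < r" "r < s" "v \<noteq> 0"
  shows "admissible_segment C p (p + s *\<^sub>R v) (p + r *\<^sub>R v)"
proof -
  \<comment> \<open>The coefficient solves \<open>s + c * (r - s) = 0\<close>, which places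
    \<open>p\<close> on the line through the two points.\<close>
  have "(s / (s - r)) *\<^sub>R ((p + r *\<^sub>R v) - (p + s *\<^sub>R v)) = (s / (s - r) * (r - s)) *\<^sub>R v"
    by (simp flip: scaleR_diff_left)
  also have "s / (s - r) * (r - s) = - s"
    using assms(4) by (simp add: divide_simps) (simp add: algebra_simps)
  finally have "p = (p + s *\<^sub>R v) + (s / (s - r)) *\<^sub>R ((p + r *\<^sub>R v) - (p + s *\<^sub>R v))"
    by simp
  then have "p \<in> affine hull {p + s *\<^sub>R v, p + r *\<^sub>R v}"
    unfolding affine_hull_2_alt by blast
  moreover have "p + r *\<^sub>R v = (1 - r / s) *\<^sub>R p + (r / s) *\<^sub>R (p + s *\<^sub>R v)"
    using assms by (simp add: algebra_simps)
  then have "p + r *\<^sub>R v \<in> closed_segment p (p + s *\<^sub>R v)"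
    using assms unfolding in_segment by (intro exI[of _ "r / s"]) auto
  ultimately show ?thesis
    using assms by (simp add: admissible_segment_def)
qed

text \<open>Measuring along \<open>A - B\<close> itself, not along a unit vector, makes the two
  parameters differ by exactly 1. Positivity of \<open>b\<close> comes from \<open>B\<close> being
  in \<open>C\<close> while \<open>p\<close> is not.\<close>

lemma admissible_segment_parametrization:
  assumes "admissible_segment C p A B" "closed C" "p \<notin> C"
  obtains a b where "0 < b" "a - b = 1" "A = p + a *\<^sub>R (A - B)" "B = p + b *\<^sub>R (A - B)"
proof -
  have AB: "A \<noteq> B" "B \<in> closed_segment p A" "B \<in> C"
    using assms by (auto simp: admissible_segment_def frontier_def)
  then obtain u where u: "0 \<le> u" "u \<le> 1" "B = (1 - u) *\<^sub>R p + u *\<^sub>R A"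
    by (auto simp: in_segment)
  have "u \<noteq> 0" "u \<noteq> 1"
    using u AB assms(3) by auto
  have B: "B = p + u *\<^sub>R (A - p)"
    by (simp add: u(3) algebra_simps)
  have d: "A - B = (1 - u) *\<^sub>R (A - p)"
    by (simp add: u(3) algebra_simps)
  show thesis
  proof
    show "0 < u / (1 - u)" "1 / (1 - u) - u / (1 - u) = 1"
      using u(1,2) \<open>u \<noteq> 0\<close> \<open>u \<noteq> 1\<close> by (auto simp: field_simps)
    show "A = p + (1 / (1 - u)) *\<^sub>R (A - B)"
      unfolding d using \<open>u \<noteq> 1\<close> by simp
    show "B = p + (u / (1 - u)) *\<^sub>R (A - B)"
      unfolding d using \<open>u \<noteq> 1\<close> B by simp
  qed
qed

text \<open>Cut the chord at one of its interior points: by convexity each piece is interior to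
  \<open>C\<close> except possibly at its outer end.\<close>

lemma interior_chord:
  fixes C :: "'a::euclidean_space set"
  assumes "convex C" "A \<in> closure C" "B \<in> closure C"
    and "closed_segment A B \<inter> interior C \<noteq> {}"
  shows "open_segment A B \<subseteq> interior C"
proof -
  obtain x where x: "x \<in> closed_segment A B" "x \<in> interior C"
    using assms(4) by blast
  have "open_segment A x \<subseteq> interior C" "open_segment B x \<subseteq> interior C"
    using in_interior_closure_convex_segment[OF assms(1) x(2) assms(2)]
      in_interior_closure_convex_segment[OF assms(1) x(2) assms(3)]
    by (simp_all add: open_segment_commute[of _ x])
  moreover have "closed_segment A B = closed_segment A x \<union> closed_segment x B"
    using x(1) by (rule Un_closed_segment[symmetric])
  ultimately show ?thesis
    using x(2) by (auto simp: open_segment_def closed_segment_commute)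
qed

text \<open>The sign \<open>\<sigma>\<close> is 1 for the end-point \<open>A\<close> and -1 for the end-point \<open>B\<close>.\<close>

lemma frontier_near_endpoint:
  assumes "closed C" "0 < \<epsilon>"
    and inn: "p + (a - \<sigma> * \<epsilon>) *\<^sub>R d \<in> interior C"
    and supp: "\<And>x. x \<in> C \<Longrightarrow> \<sigma> * (n \<bullet> (x - p)) \<le> \<sigma> * a"
    and "n \<bullet> d = 1" "\<bar>\<sigma>\<bar> = 1"
  shows "\<forall>\<^sub>F t in nhds 0. \<exists>s. \<bar>s - a\<bar> \<le> \<epsilon> \<and> p + s *\<^sub>R (d + t *\<^sub>R w) \<in> frontier C \<and>
           \<sigma> * s \<le> \<sigma> * (a / (1 + t * (n \<bullet> w)))"
proof -
  have "((\<lambda>t. p + (a - \<sigma> * \<epsilon>) *\<^sub>R (d + t *\<^sub>R w)) \<longlongrightarrow> p + (a - \<sigma> * \<epsilon>) *\<^sub>R (d + 0 *\<^sub>R w)) (nhds 0)"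
    by (intro tendsto_intros filterlim_ident)
  then have 1: "\<forall>\<^sub>F t in nhds 0. p + (a - \<sigma> * \<epsilon>) *\<^sub>R (d + t *\<^sub>R w) \<in> interior C"
    by (rule topological_tendstoD) (use inn in auto)
  have "((\<lambda>t. 1 + t * (n \<bullet> w)) \<longlongrightarrow> 1 + 0 * (n \<bullet> w)) (nhds 0)"
    by (intro tendsto_intros filterlim_ident)
  then have 2: "\<forall>\<^sub>F t in nhds 0. 0 < 1 + t * (n \<bullet> w)"
    by (rule order_tendstoD) auto
  \<comment> \<open>At \<open>t = 0\<close> the two sides of the inequality differ by \<epsilon>, so
    it persists for small \<open>t\<close>. It says that the point with parameter
    \<open>a + \<sigma> * \<epsilon>\<close> is beyond the supporting hyperplane, hence outside
    \<open>C\<close>.\<close>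
  have "((\<lambda>t. \<sigma> * (a + \<sigma> * \<epsilon>) * (1 + t * (n \<bullet> w))) \<longlongrightarrow> \<sigma> * (a + \<sigma> * \<epsilon>) * (1 + 0 * (n \<bullet> w))) (nhds 0)"
    by (intro tendsto_intros filterlim_ident)
  moreover have "\<sigma> * \<sigma> = 1"
    using \<open>\<bar>\<sigma>\<bar> = 1\<close> by (metis abs_mult_self_eq mult_1)
  then have "\<sigma> * a < \<sigma> * (a + \<sigma> * \<epsilon>) * (1 + 0 * (n \<bullet> w))"
    using \<open>0 < \<epsilon>\<close> by (simp add: algebra_simps)
  ultimately have 3: "\<forall>\<^sub>F t in nhds 0. \<sigma> * a < \<sigma> * (a + \<sigma> * \<epsilon>) * (1 + t * (n \<bullet> w))"
    by (rule order_tendstoD)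
  from 1 2 3 show ?thesis
  proof eventually_elim
    case (elim t)
    let ?v = "d + t *\<^sub>R w"
    \<comment> \<open>The hyperplane is where \<open>n \<bullet> (x - p) = a\<close>; since
      \<open>n \<bullet> d = 1\<close>, the rotated line meets it at
      \<open>s = a / (1 + t * (n \<bullet> w))\<close>.\<close>
    have bound: "\<sigma> * s * (1 + t * (n \<bullet> w)) \<le> \<sigma> * a" if "p + s *\<^sub>R ?v \<in> C" for s
      using supp[OF that] \<open>n \<bullet> d = 1\<close> by (simp add: inner_add_right mult.assoc)
    have "p + (a - \<sigma> * \<epsilon>) *\<^sub>R ?v \<in> C" "p + (a + \<sigma> * \<epsilon>) *\<^sub>R ?v \<notin> C"
      using elim(1) interior_subset bound[of "a + \<sigma> * \<epsilon>"] elim(3) by auto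
    then obtain s where s: "s \<in> closed_segment (a - \<sigma> * \<epsilon>) (a + \<sigma> * \<epsilon>)"
      "p + s *\<^sub>R ?v \<in> frontier C"
      using closed_segment_crosses_frontier[of p "a - \<sigma> * \<epsilon>" ?v C "a + \<sigma> * \<epsilon>"] by auto
    have "\<sigma> = 1 \<or> \<sigma> = -1"
      using \<open>\<bar>\<sigma>\<bar> = 1\<close> by linarith
    then have "\<bar>s - a\<bar> \<le> \<epsilon>"
      using s(1) \<open>0 < \<epsilon>\<close> by (auto simp: closed_segment_eq_real_ivl split: if_splits)
    moreover have "p + s *\<^sub>R ?v \<in> C"
      using s(2) \<open>closed C\<close> by (auto simp: frontier_def)
    then have "\<sigma> * s \<le> \<sigma> * (a / (1 + t * (n \<bullet> w)))"
      using bound[of s] elim(2) by (simp add: field_simps)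
    ultimately show ?case
      using s(2) by blast
  qed
qed

section \<open>First variation of the chord length\<close>

text \<open>With \<open>n\<close> outward at \<open>A\<close> and \<open>m\<close> inward at
  \<open>B\<close>, both scaled to have product 1 with \<open>A - B\<close>, rotation in every
  direction orthogonal to \<open>A - B\<close> shows that
  \<open>a *\<^sub>R n - b *\<^sub>R m\<close> is parallel to \<open>A - B\<close>; the scaling
  fixes the factor. As \<open>a\<close> and \<open>b\<close> are nonzero, either normal determines
  the other.\<close>

lemma local_minimizer_normals:
  fixes C :: "'a::euclidean_space set"
  assumes C: "closed C" "convex C" "closed_segment A B \<inter> interior C \<noteq> {}"
    and min: "local_minimizer C p A B"
    and par: "0 < b" "a - b = 1" "A = p + a *\<^sub>R (A - B)" "B = p + b *\<^sub>R (A - B)"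
    and n: "n \<bullet> (A - B) = 1" "\<And>x. x \<in> C \<Longrightarrow> n \<bullet> x \<le> n \<bullet> A"
    and m: "m \<bullet> (A - B) = 1" "\<And>x. x \<in> C \<Longrightarrow> m \<bullet> B \<le> m \<bullet> x"
  shows "((A - B) \<bullet> (A - B)) *\<^sub>R (a *\<^sub>R n - b *\<^sub>R m) = A - B"
proof -
  define d where "d = A - B"
  have pA: "A = p + a *\<^sub>R d" and pB: "B = p + b *\<^sub>R d"
    using par(3,4) unfolding d_def .
  have nd: "n \<bullet> d = 1" and md: "m \<bullet> d = 1"
    using n m by (simp_all add: d_def)
  have "d \<noteq> 0"
    using nd by auto
  then have D: "0 < d \<bullet> d"
    by simp
  obtain U V where UV: "open U" "open V" "A \<in> U" "B \<in> V"
    and min': "\<And>A' B'. \<lbrakk>A' \<in> frontier C \<inter> U; B' \<in> frontier C \<inter> V; admissible_segment C p A' B'\<rbrakk>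
        \<Longrightarrow> dist A B \<le> dist A' B'"
    using min unfolding local_minimizer_def by blast
  have "A \<in> closure C" "B \<in> closure C"
    using min by (auto simp: local_minimizer_def admissible_segment_def frontier_def)
  then have seg: "open_segment A B \<subseteq> interior C"
    using C by (intro interior_chord)
  have inn: "p + s *\<^sub>R d \<in> interior C" if "b < s" "s < a" for s
  proof -
    have "p + s *\<^sub>R d = (1 - (a - s)) *\<^sub>R A + (a - s) *\<^sub>R B"
    proof -
      have "p + s *\<^sub>R d = A - (a - s) *\<^sub>R d"
        by (simp add: pA algebra_simps)
      then show ?thesis
        by (simp add: d_def algebra_simps)
    qed
    then have "p + s *\<^sub>R d \<in> open_segment A B"
      using that par(2) \<open>d \<noteq> 0\<close> unfolding in_segment d_def by (intro conjI exI[of _ "a - s"]) auto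
    then show ?thesis
      using seg by blast
  qed
  \<comment> \<open>Continuity jointly in the parameter and the rotation: one \<epsilon> must serve
    for all small \<open>t\<close>, because the frontier points found on the rotated lines are only
    known up to their parameter window.\<close>
  have near: "\<exists>\<epsilon>>0. \<forall>s t. \<bar>s - c\<bar> \<le> \<epsilon> \<and> \<bar>t\<bar> < \<epsilon> \<longrightarrow> p + s *\<^sub>R (d + t *\<^sub>R w) \<in> T"
    if "open T" "p + c *\<^sub>R d \<in> T" for c w T
  proof -
    have "((\<lambda>z. p + fst z *\<^sub>R (d + snd z *\<^sub>R w)) \<longlongrightarrow>
        p + fst (c, 0::real) *\<^sub>R (d + snd (c, 0::real) *\<^sub>R w)) (nhds (c, 0))"
      by (intro tendsto_intros filterlim_ident)
    then have "\<forall>\<^sub>F z in nhds (c, 0). p + fst z *\<^sub>R (d + snd z *\<^sub>R w) \<in> T"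
      using that by (intro topological_tendstoD) auto
    then obtain e where e: "e > 0" "\<And>z. dist z (c, 0) < e \<Longrightarrow> p + fst z *\<^sub>R (d + snd z *\<^sub>R w) \<in> T"
      unfolding eventually_nhds_metric by blast
    have "p + s *\<^sub>R (d + t *\<^sub>R w) \<in> T" if "\<bar>s - c\<bar> \<le> e / 2" "\<bar>t\<bar> < e / 2" for s t
    proof -
      have "dist (s, t) (c, 0) \<le> \<bar>s - c\<bar> + \<bar>t\<bar>"
        by (simp add: dist_Pair_Pair dist_real_def sqrt_sum_squares_le_sum_abs)
      then show ?thesis
        using e(2)[of "(s, t)"] that by simp
    qed
    then show ?thesis
      using e(1) by (intro exI[of _ "e / 2"]) auto
  qed
  have orth: "a * (n \<bullet> w) = b * (m \<bullet> w)" if w: "d \<bullet> w = 0" for w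
  proof (rule first_order_condition[OF D par(2)])
    obtain e1 where e1: "e1 > 0" "\<And>s t. \<bar>s - a\<bar> \<le> e1 \<Longrightarrow> \<bar>t\<bar> < e1 \<Longrightarrow> p + s *\<^sub>R (d + t *\<^sub>R w) \<in> U"
      using near[OF UV(1), of a w] UV(3) pA by metis
    obtain e2 where e2: "e2 > 0" "\<And>s t. \<bar>s - b\<bar> \<le> e2 \<Longrightarrow> \<bar>t\<bar> < e2 \<Longrightarrow> p + s *\<^sub>R (d + t *\<^sub>R w) \<in> V"
      using near[OF UV(2), of b w] UV(4) pB by metis
    \<comment> \<open>\<open>e1\<close> and \<open>e2\<close> keep the new end-points in
      \<open>U\<close> and \<open>V\<close>, and \<open>b / 2\<close> keeps \<open>r\<close>
      positive. Since \<open>a - b = 1\<close>, the bound \<open>1 / 3\<close> separates the windows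
      around \<open>a\<close> and \<open>b\<close>, so that \<open>r < s\<close>, and puts the inner
      test points strictly inside the chord.\<close>
    define \<epsilon> where "\<epsilon> = Min {e1, e2, b / 2, 1 / 3}"
    have \<epsilon>: "0 < \<epsilon>" "\<epsilon> \<le> e1" "\<epsilon> \<le> e2" "\<epsilon> < b" "\<epsilon> < 1 / 2"
      using e1(1) e2(1) par(1) by (auto simp: \<epsilon>_def min_def)
    have "\<forall>\<^sub>F t in nhds 0. \<exists>s. \<bar>s - a\<bar> \<le> \<epsilon> \<and> p + s *\<^sub>R (d + t *\<^sub>R w) \<in> frontier C \<and>
           1 * s \<le> 1 * (a / (1 + t * (n \<bullet> w)))"
    proof (rule frontier_near_endpoint)
      show "p + (a - 1 * \<epsilon>) *\<^sub>R d \<in> interior C"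
        using \<epsilon> par(2) by (intro inn) auto
      show "1 * (n \<bullet> (x - p)) \<le> 1 * a" if "x \<in> C" for x
        using n(2)[OF that] nd by (simp add: pA inner_diff_right inner_add_right)
    qed (use C \<epsilon> nd in auto)
    moreover have "\<forall>\<^sub>F t in nhds 0. \<exists>s. \<bar>s - b\<bar> \<le> \<epsilon> \<and> p + s *\<^sub>R (d + t *\<^sub>R w) \<in> frontier C \<and>
           (-1) * s \<le> (-1) * (b / (1 + t * (m \<bullet> w)))"
    proof (rule frontier_near_endpoint)
      show "p + (b - (-1) * \<epsilon>) *\<^sub>R d \<in> interior C"
        using \<epsilon> par(2) by (intro inn) auto
      show "(-1) * (m \<bullet> (x - p)) \<le> (-1) * b" if "x \<in> C" for x
        using m(2)[OF that] md by (simp add: pB inner_diff_right inner_add_right)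
    qed (use C \<epsilon> md in auto)
    moreover have "\<forall>\<^sub>F t in nhds 0. \<bar>t\<bar> < \<epsilon>"
      using \<epsilon>(1) by (auto simp: eventually_nhds_metric dist_real_def)
    ultimately show "\<forall>\<^sub>F t in nhds 0. sqrt (d \<bullet> d) \<le>
        (a / (1 + t * (n \<bullet> w)) - b / (1 + t * (m \<bullet> w))) * sqrt (d \<bullet> d + t\<^sup>2 * (w \<bullet> w))"
    proof eventually_elim
      case (elim t)
      let ?v = "d + t *\<^sub>R w"
      obtain s where s: "\<bar>s - a\<bar> \<le> \<epsilon>" "p + s *\<^sub>R ?v \<in> frontier C" "s \<le> a / (1 + t * (n \<bullet> w))"
        using elim(1) by auto
      obtain r where r: "\<bar>r - b\<bar> \<le> \<epsilon>" "p + r *\<^sub>R ?v \<in> frontier C" "b / (1 + t * (m \<bullet> w)) \<le> r"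
        using elim(2) by auto
      have "?v \<bullet> ?v = d \<bullet> d + t\<^sup>2 * (w \<bullet> w)"
        using w by (simp add: inner_add_left inner_add_right inner_commute[of w d] power2_eq_square)
      then have nv: "norm ?v = sqrt (d \<bullet> d + t\<^sup>2 * (w \<bullet> w))"
        by (simp add: norm_eq_sqrt_inner)
      have "d \<bullet> ?v \<noteq> 0"
        using w D by (simp add: inner_add_right)
      then have "?v \<noteq> 0"
        by auto
      moreover have "0 < r" "r < s"
        using s(1) r(1) \<epsilon> par(1,2) by linarith+
      ultimately have "admissible_segment C p (p + s *\<^sub>R ?v) (p + r *\<^sub>R ?v)"
        using s(2) r(2) by (intro admissible_segmentI)
      moreover have "p + s *\<^sub>R ?v \<in> U" "p + r *\<^sub>R ?v \<in> V"
        using e1(2) e2(2) s(1) r(1) elim(3) \<epsilon> by auto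
      ultimately have "dist A B \<le> dist (p + s *\<^sub>R ?v) (p + r *\<^sub>R ?v)"
        using s(2) r(2) by (intro min') auto
      also have "\<dots> = (s - r) * norm ?v"
        using \<open>r < s\<close> by (simp add: dist_norm flip: scaleR_diff_left)
      also have "\<dots> \<le> (a / (1 + t * (n \<bullet> w)) - b / (1 + t * (m \<bullet> w))) * norm ?v"
        using s(3) r(3) by (intro mult_right_mono) auto
      finally show ?case
        by (simp only: nv dist_norm d_def[symmetric] norm_eq_sqrt_inner[of d])
    qed
  qed
  define k where "k = a *\<^sub>R n - b *\<^sub>R m"
  have kd: "k \<bullet> d = 1"
    using nd md par(2) by (simp add: k_def inner_diff_left)
  \<comment> \<open>Up to the factor \<open>d \<bullet> d\<close>, this is the component of
    \<open>k\<close> orthogonal to \<open>d\<close>. Using it as the direction \<open>w\<close> in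
    \<open>orth\<close> forces it to vanish.\<close>
  define z where "z = (d \<bullet> d) *\<^sub>R k - d"
  have "d \<bullet> z = 0"
    using kd by (simp add: z_def inner_diff_right inner_commute[of d k])
  moreover from orth[OF this] have "k \<bullet> z = 0"
    by (simp add: k_def inner_diff_left)
  ultimately have "z \<bullet> z = 0"
    by (subst z_def) (simp add: inner_diff_left)
  then show ?thesis
    by (simp add: z_def k_def d_def)
qed

section \<open>Supporting hyperplanes and normalized normals\<close>

text \<open>The chord contains an interior point of \<open>C\<close>, which lies strictly on the
  inner side of \<open>H\<close>. Hence an outward normal has positive product with
  \<open>A - D\<close> and can be rescaled.\<close>

lemma supports_at_normalized:
  assumes "supports_at H C A" "D \<in> C" "closed_segment A D \<inter> interior C \<noteq> {}"
  obtains n where "n \<bullet> (A - D) = 1" "\<And>x. x \<in> C \<Longrightarrow> n \<bullet> x \<le> n \<bullet> A" "H = {x. n \<bullet> x = n \<bullet> A}"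
proof -
  obtain h c where h: "h \<noteq> 0" "H = {x. h \<bullet> x = c}" "C \<subseteq> {x. h \<bullet> x \<le> c}"
  proof -
    from assms(1) obtain h c where "h \<noteq> 0" "H = {x. h \<bullet> x = c}"
      "C \<subseteq> {x. h \<bullet> x \<le> c} \<or> C \<subseteq> {x. h \<bullet> x \<ge> c}"
      unfolding supports_at_def by blast
    then show thesis
      using that[of h c] that[of "-h" "-c"] by auto
  qed
  have c: "c = h \<bullet> A"
    using assms(1) h(2) by (auto simp: supports_at_def)
  obtain x where x: "x \<in> closed_segment A D" "x \<in> interior C"
    using assms(3) by blast
  have "x \<in> interior {x. h \<bullet> x \<le> c}"
    using x(2) interior_mono[OF h(3)] by blast
  then have lt: "h \<bullet> x < h \<bullet> A"
    using h(1) c by simp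
  obtain u where u: "0 \<le> u" "u \<le> 1" "x = (1 - u) *\<^sub>R A + u *\<^sub>R D"
    using x(1) by (auto simp: in_segment)
  have "0 < u * (h \<bullet> (A - D))"
    using lt by (simp add: u(3) inner_add_right inner_diff_right algebra_simps)
  then have pos: "0 < h \<bullet> (A - D)"
    using u(1) by (simp add: zero_less_mult_iff)
  show thesis
  proof
    let ?n = "h /\<^sub>R (h \<bullet> (A - D))"
    show "?n \<bullet> (A - D) = 1"
      using pos by simp
    show "?n \<bullet> x \<le> ?n \<bullet> A" if "x \<in> C" for x
      using that h(3) c pos by (auto intro!: mult_left_mono)
    show "H = {x. ?n \<bullet> x = ?n \<bullet> A}"
      using pos by (simp add: h(2) c)
  qed
qed

text \<open>Supplies the existence half of the uniqueness claims. As the interior is nonempty it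
  equals the relative interior, so a frontier point is a relative boundary point.\<close>

lemma ex_supports_at:
  fixes C :: "'a::euclidean_space set"
  assumes "closed C" "convex C" "interior C \<noteq> {}" "A \<in> frontier C"
  shows "\<exists>H. supports_at H C A"
proof -
  have "A \<in> C" "A \<notin> rel_interior C"
    using assms by (auto simp: frontier_def rel_interior_nonempty_interior)
  then obtain h where "h \<noteq> 0" "\<And>x. x \<in> C \<Longrightarrow> h \<bullet> A \<le> h \<bullet> x"
    using supporting_hyperplane_rel_boundary[OF assms(2)] by metis
  then have "supports_at {x. h \<bullet> x = h \<bullet> A} C A"
    using \<open>A \<in> C\<close> unfolding supports_at_def by blast
  then show ?thesis
    by blast
qed

lemma mem_normal_line_hyperplane:
  "A + c *\<^sub>R n \<in> normal_line {x. n \<bullet> x = h} A"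
  by (simp add: normal_line_def orthogonal_def inner_diff_right)

section \<open>Uniqueness of the hyperplanes and the common point of the normals\<close>

theorem theorem24:
  fixes C :: "(real ^ 'n) set" and p A B :: "real ^ 'n"
  assumes "CARD('n) \<ge> 2"
    and "closed C" and "convex C" and "interior C \<noteq> {}"
    and "p \<notin> C"
    and "local_minimizer C p A B"
    and "closed_segment A B \<inter> interior C \<noteq> {}"
  shows "(\<exists>!H\<^sub>1. supports_at H\<^sub>1 C A) \<and> (\<exists>!H\<^sub>2. supports_at H\<^sub>2 C B) \<and>
    (\<forall>H\<^sub>1 H\<^sub>2. supports_at H\<^sub>1 C A \<and> supports_at H\<^sub>2 C B \<longrightarrow>
       normal_line H\<^sub>1 A \<inter> normal_line H\<^sub>2 B \<inter> orthogonal_hyperplane p A B \<noteq> {})"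
proof -
  have adm: "admissible_segment C p A B"
    using assms(6) by (simp add: local_minimizer_def)
  then have fr: "A \<in> frontier C" "B \<in> frontier C" "A \<noteq> B"
    by (auto simp: admissible_segment_def)
  then have AB: "A \<in> C" "B \<in> C"
    using assms(2) by (auto simp: frontier_def)
  obtain a b where par: "0 < b" "a - b = 1" "A = p + a *\<^sub>R (A - B)" "B = p + b *\<^sub>R (A - B)"
    using admissible_segment_parametrization adm assms(2,5) by blast
  define D where "D = (A - B) \<bullet> (A - B)"
  have "D \<noteq> 0"
    using fr(3) by (simp add: D_def)
  have nA: "\<exists>n. n \<bullet> (A - B) = 1 \<and> (\<forall>x\<in>C. n \<bullet> x \<le> n \<bullet> A) \<and> H = {x. n \<bullet> x = n \<bullet> A}"
    if "supports_at H C A" for H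
    using supports_at_normalized[OF that AB(2) assms(7)] by metis
  have nB: "\<exists>m. m \<bullet> (A - B) = 1 \<and> (\<forall>x\<in>C. m \<bullet> B \<le> m \<bullet> x) \<and> H = {x. m \<bullet> x = m \<bullet> B}"
    if H: "supports_at H C B" for H
  proof -
    obtain m where m: "m \<bullet> (B - A) = 1" "\<And>x. x \<in> C \<Longrightarrow> m \<bullet> x \<le> m \<bullet> B" "H = {x. m \<bullet> x = m \<bullet> B}"
      using supports_at_normalized[OF H AB(1)] assms(7) by (metis closed_segment_commute)
    then show ?thesis
      \<comment> \<open>The outward normal at \<open>B\<close> has product 1 with
        \<open>B - A\<close>; its negative is the inward normal with product 1 with
        \<open>A - B\<close>.\<close>
      by (intro exI[of _ "- m"]) (auto simp: inner_diff_right)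
  qed
  have rel: "D *\<^sub>R (a *\<^sub>R n - b *\<^sub>R m) = A - B"
    if "n \<bullet> (A - B) = 1" "\<forall>x\<in>C. n \<bullet> x \<le> n \<bullet> A" "m \<bullet> (A - B) = 1" "\<forall>x\<in>C. m \<bullet> B \<le> m \<bullet> x" for n m
    unfolding D_def by (rule local_minimizer_normals[OF assms(2,3,7,6) par]) (use that in auto)
  obtain HA HB where HAB: "supports_at HA C A" "supports_at HB C B"
    using ex_supports_at assms(2-4) fr by metis
  \<comment> \<open>Both hyperplanes at \<open>A\<close> are compared through the same normal
    \<open>m\<close> at \<open>B\<close>: the relation then leaves only one possible
    \<open>n\<close>, since \<open>D\<close> and \<open>a = b + 1\<close> are nonzero.\<close>
  have uniqueA: "H = HA" if H: "supports_at H C A" for H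
  proof -
    obtain n n' m where n: "D *\<^sub>R (a *\<^sub>R n - b *\<^sub>R m) = A - B" "H = {x. n \<bullet> x = n \<bullet> A}"
      and n': "D *\<^sub>R (a *\<^sub>R n' - b *\<^sub>R m) = A - B" "HA = {x. n' \<bullet> x = n' \<bullet> A}"
      using nA[OF H] nA[OF HAB(1)] nB[OF HAB(2)] rel by metis
    have "D *\<^sub>R (a *\<^sub>R n - b *\<^sub>R m) = D *\<^sub>R (a *\<^sub>R n' - b *\<^sub>R m)"
      using n n' by simp
    then have "n = n'"
      using \<open>D \<noteq> 0\<close> par(1,2) by auto
    then show ?thesis
      using n n' by simp
  qed
  have uniqueB: "H = HB" if H: "supports_at H C B" for H
  proof -
    obtain n m m' where m: "D *\<^sub>R (a *\<^sub>R n - b *\<^sub>R m) = A - B" "H = {x. m \<bullet> x = m \<bullet> B}"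
      and m': "D *\<^sub>R (a *\<^sub>R n - b *\<^sub>R m') = A - B" "HB = {x. m' \<bullet> x = m' \<bullet> B}"
      using nB[OF H] nB[OF HAB(2)] nA[OF HAB(1)] rel by metis
    have "D *\<^sub>R (a *\<^sub>R n - b *\<^sub>R m) = D *\<^sub>R (a *\<^sub>R n - b *\<^sub>R m')"
      using m m' by simp
    then have "m = m'"
      using \<open>D \<noteq> 0\<close> par(1) by auto
    then show ?thesis
      using m m' by simp
  qed
  have meet: "normal_line H1 A \<inter> normal_line H2 B \<inter> orthogonal_hyperplane p A B \<noteq> {}"
    if H: "supports_at H1 C A" "supports_at H2 C B" for H1 H2
  proof -
    obtain n m where n: "n \<bullet> (A - B) = 1" "H1 = {x. n \<bullet> x = n \<bullet> A}"
      and m: "H2 = {x. m \<bullet> x = m \<bullet> B}" and nm: "D *\<^sub>R (a *\<^sub>R n - b *\<^sub>R m) = A - B"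
      using nA[OF H(1)] nB[OF H(2)] rel by metis
    \<comment> \<open>Moving terms in \<open>nm\<close> gives
      \<open>A - (a * D) *\<^sub>R n = B - (b * D) *\<^sub>R m\<close>, a point visibly on both
      normal lines.\<close>
    define X where "X = A + (- (a * D)) *\<^sub>R n"
    have "X = B + (- (b * D)) *\<^sub>R m"
      using nm by (simp add: X_def algebra_simps)
    then have "X \<in> normal_line H1 A" "X \<in> normal_line H2 B"
      using mem_normal_line_hyperplane n(2) m X_def by metis+
    \<comment> \<open>The right-hand side is orthogonal to \<open>A - B\<close> because
      \<open>n \<bullet> (A - B) = 1\<close> and \<open>D\<close> is the squared length of
      \<open>A - B\<close>.\<close>
    moreover have "X - p = a *\<^sub>R ((A - B) - D *\<^sub>R n)"
      by (subst X_def, subst par(3)) (simp add: algebra_simps)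
    then have "X \<in> orthogonal_hyperplane p A B"
      using n(1) by (simp add: orthogonal_hyperplane_def orthogonal_def inner_diff_left[of "A - B"] D_def)
    ultimately show ?thesis
      by blast
  qed
  show ?thesis
    using HAB uniqueA uniqueB meet by blast
qed

end
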